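(* Let $n\ge 1$ be an integer and let $a_1=r_1e^{i\theta_1}$, $a_2=r_2e^{i\theta_2}$ be two distinct points with $0<r_1,r_2<1$ and $\theta_1,\theta_2\in\mathbb{R}$. Let $$B(z)=b_1(z)^n\,b_2(z)^n,\qquad b_j(z)=\frac{\overline{a}_j}{|a_j|}\,\frac{a_j-z}{1-\overline{a}_jz},\quad j=1,2 .$$ Let $b$ be the zero of $B'$ in the open unit disc different from $a_1$ and $a_2$, let $\beta$ be an argument of $B(b)$, put $\lambda=e^{i\beta/n}$, and let $\omega_k=e^{2\pi i k/n}$, $k=0,1,\dots,n-1$. For $k=0,\dots,n-1$ and $t\ge 0$ set $$z_{1,2}^{(k)}(t)=\frac{(r_1-\omega_k r_2\lambda t)e^{i\theta_1}+(r_2-\omega_k r_1\lambda t)e^{i\theta_2}\pm e^{i(\theta_1+\theta_2)}\sqrt{\Delta_k(t)}}{2(1-\omega_k r_1r_2\lambda t)},$$ where $$\Delta_k(t)=\left[(\omega_k r_1\lambda t-r_2)e^{-i\theta_1}-(\omega_k r_2\lambda t-r_1)e^{-i\theta_2}\right]^2+4\omega_k(1-r_1^2)(1-r_2^2)\lambda t\,e^{-i(\theta_1+\theta_2)} .$$ Then the domains bounded by the curves $t\mapsto z_{1}^{(k)}(t)$ and $t\mapsto z_2^{(k)}(t)$, $t\ge 0$, $k=0,1,\dots,n-1$, are fundamental domains of $(\widehat{\mathbb{C}},B)$.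
   Context: $\widehat{\mathbb{C}}=\mathbb{C}\cup\{\infty\}$ is the Riemann sphere, and $(\widehat{\mathbb{C}},B)$ denotes $\widehat{\mathbb{C}}$ viewed as a (branched) covering Riemann surface of $\widehat{\mathbb{C}}$ with projection $w=B(z)$. A fundamental domain of $(\widehat{\mathbb{C}},B)$ is a domain $\Omega\subset\widehat{\mathbb{C}}$ that is mapped conformally (i.e. holomorphically and injectively) by $B$ onto $\widehat{\mathbb{C}}$ from which a slit (a closed arc) has been removed. For each $k$ and $t$, the unordered pair $\{z_1^{(k)}(t),z_2^{(k)}(t)\}$ is the pair of solutions in $\widehat{\mathbb{C}}$ of the quadratic equation equivalent to $b_1(z)b_2(z)=\omega_k\lambda t$ (with the value $\infty$ allowed for one solution when the denominator $1-\omega_k r_1r_2\lambda t$ vanishes); the choice of square root is immaterial for the union of the curves. Thus the union of the curves is the set of solutions of $B(z)=e^{i\beta}t^n$, $t\ge 0$. The domains bounded by the curves are the connected components of the complement in $\widehat{\mathbb{C}}$ of the closure of the union of all these curves (the closure adds the limit points $1/\overline{a}_1,1/\overline{a}_2$ as $t\to\infty$). The zeros of $B'$ in the open unit disc other than possibly $a_1,a_2$ consist of the single point $b$. *)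

theory Defs
  imports "HOL-Complex_Analysis.Complex_Analysis"
begin

section \<open>The Riemann sphere\<close>

text \<open>The point at infinity is \<^term>\<open>None\<close>.\<close>

type_synonym rsphere = "complex option"

definition riemann_sphere :: "rsphere topology" where
  "riemann_sphere = Alexandroff_compactification (euclidean :: complex topology)"

definition sphere_inversion :: "rsphere \<Rightarrow> rsphere" where
  "sphere_inversion p =
     (case p of None \<Rightarrow> Some 0 | Some z \<Rightarrow> (if z = 0 then None else Some (1 / z)))"

text \<open>
  The two charts of the sphere are the partial maps \<open>the\<close> and \<open>the \<circ> sphere_inversion\<close>, defined
  where the argument of \<open>the\<close> is not \<open>None\<close>; their inverses are \<open>Some\<close> and
  \<open>sphere_inversion \<circ> Some\<close>. A continuous map is holomorphic if all its representations in these
  charts are; continuity makes the domains of these representations open.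
\<close>

definition sphere_holomorphic_on :: "(rsphere \<Rightarrow> rsphere) \<Rightarrow> rsphere set \<Rightarrow> bool" where
  "sphere_holomorphic_on F \<Omega> \<longleftrightarrow>
     openin riemann_sphere \<Omega> \<and>
     continuous_map (subtopology riemann_sphere \<Omega>) riemann_sphere F \<and>
     (\<forall>\<phi> \<in> {id, sphere_inversion}. \<forall>\<psi> \<in> {id, sphere_inversion}.
        (\<lambda>z. the (\<psi> (F (\<phi> (Some z))))) holomorphic_on
          {z. \<phi> (Some z) \<in> \<Omega> \<and> \<psi> (F (\<phi> (Some z))) \<noteq> None})"

definition sphere_domain :: "rsphere set \<Rightarrow> bool" where
  "sphere_domain \<Omega> \<longleftrightarrow>
     \<Omega> \<noteq> {} \<and> openin riemann_sphere \<Omega> \<and> connectedin riemann_sphere \<Omega>"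

definition sphere_arc :: "rsphere set \<Rightarrow> bool" where
  "sphere_arc L \<longleftrightarrow>
     (\<exists>g. embedding_map (top_of_set {0..1::real}) riemann_sphere g \<and> L = g ` {0..1})"

definition fundamental_domain :: "(rsphere \<Rightarrow> rsphere) \<Rightarrow> rsphere set \<Rightarrow> bool" where
  "fundamental_domain F \<Omega> \<longleftrightarrow>
     sphere_domain \<Omega> \<and> sphere_holomorphic_on F \<Omega> \<and> inj_on F \<Omega> \<and>
     (\<exists>L. sphere_arc L \<and> F ` \<Omega> = topspace riemann_sphere - L)"

section \<open>The Blaschke product\<close>

definition blaschke_factor :: "complex \<Rightarrow> complex \<Rightarrow> complex" where
  "blaschke_factor a z = cnj a / of_real (norm a) * ((a - z) / (1 - cnj a * z))"

definition blaschke_prod :: "nat \<Rightarrow> complex \<Rightarrow> complex \<Rightarrow> complex \<Rightarrow> complex" where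
  "blaschke_prod n a1 a2 z = blaschke_factor a1 z ^ n * blaschke_factor a2 z ^ n"

text \<open>
  The same rational function as a map of the sphere, for nonzero \<open>a1\<close>, \<open>a2\<close> in the unit disc and
  \<open>n \<ge> 1\<close>. The factor of \<open>a\<close> tends to \<open>1 / \<bar>a\<bar>\<close> at infinity.
\<close>

definition blaschke_sphere :: "nat \<Rightarrow> complex \<Rightarrow> complex \<Rightarrow> rsphere \<Rightarrow> rsphere" where
  "blaschke_sphere n a1 a2 p =
     (case p of
        None \<Rightarrow> Some (of_real ((1 / norm a1) ^ n * (1 / norm a2) ^ n))
      | Some z \<Rightarrow>
          (if 1 - cnj a1 * z = 0 \<or> 1 - cnj a2 * z = 0 then None
           else Some (blaschke_prod n a1 a2 z)))"

section \<open>The curves\<close>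

text \<open>
  In the following, \<open>w\<close> stands for \<open>\<omega>\<^sub>k \<lambda> t\<close>. With \<open>a\<^sub>j = r\<^sub>j cis \<theta>\<^sub>j\<close>, the equation
  \<open>blaschke_factor a\<^sub>1 z * blaschke_factor a\<^sub>2 z = w\<close> is equivalent to the quadratic equation
  \<open>curve_den * z\<^sup>2 - curve_lin * z + (r\<^sub>1 r\<^sub>2 - w) * cis (\<theta>\<^sub>1 + \<theta>\<^sub>2) = 0\<close>,
  whose discriminant is \<open>cis (\<theta>\<^sub>1 + \<theta>\<^sub>2)\<^sup>2 * curve_disc\<close>.
\<close>

definition curve_den :: "real \<Rightarrow> real \<Rightarrow> complex \<Rightarrow> complex" where
  "curve_den r1 r2 w = 1 - w * of_real r1 * of_real r2"

definition curve_lin :: "real \<Rightarrow> real \<Rightarrow> real \<Rightarrow> real \<Rightarrow> complex \<Rightarrow> complex" where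
  "curve_lin r1 \<theta>1 r2 \<theta>2 w =
     (of_real r1 - w * of_real r2) * cis \<theta>1 + (of_real r2 - w * of_real r1) * cis \<theta>2"

definition curve_disc :: "real \<Rightarrow> real \<Rightarrow> real \<Rightarrow> real \<Rightarrow> complex \<Rightarrow> complex" where
  "curve_disc r1 \<theta>1 r2 \<theta>2 w =
     ((w * of_real r1 - of_real r2) * cis (- \<theta>1) - (w * of_real r2 - of_real r1) * cis (- \<theta>2))\<^sup>2
     + 4 * w * (1 - (of_real r1)\<^sup>2) * (1 - (of_real r2)\<^sup>2) * cis (- (\<theta>1 + \<theta>2))"

text \<open>
  The two solutions are obtained for \<open>\<sigma> = 1\<close> and \<open>\<sigma> = -1\<close>. If the leading coefficient
  \<^term>\<open>curve_den r1 r2 w\<close> vanishes, the usual formula is a nonzero number divided by 0 for the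
  solution infinity, and 0 divided by 0 for the other one. The latter is given by the equivalent
  formula \<open>2 C / (curve_lin - \<sigma> cis (\<theta>\<^sub>1 + \<theta>\<^sub>2) \<surd>curve_disc)\<close> with \<open>C\<close> the constant coefficient,
  which is nonzero in this case; the value infinity arises from a vanishing denominator. If also
  \<open>curve_lin\<close> vanishes, which happens for \<open>a\<^sub>2 = -a\<^sub>1\<close>, infinity is a double solution.
\<close>

definition curve_point :: "real \<Rightarrow> real \<Rightarrow> real \<Rightarrow> real \<Rightarrow> complex \<Rightarrow> complex \<Rightarrow> rsphere" where
  "curve_point r1 \<theta>1 r2 \<theta>2 \<sigma> w =
     (let P = curve_lin r1 \<theta>1 r2 \<theta>2 w;
          S = cis (\<theta>1 + \<theta>2) * csqrt (curve_disc r1 \<theta>1 r2 \<theta>2 w)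
      in if curve_den r1 r2 w \<noteq> 0 then Some ((P + \<sigma> * S) / (2 * curve_den r1 r2 w))
         else if P - \<sigma> * S = 0 then None
         else Some (2 * ((of_real r1 * of_real r2 - w) * cis (\<theta>1 + \<theta>2)) / (P - \<sigma> * S)))"

definition domains_bounded_by :: "rsphere set \<Rightarrow> rsphere set set" where
  "domains_bounded_by C =
     connected_components_of
       (subtopology riemann_sphere (topspace riemann_sphere - riemann_sphere closure_of C))"

end

theory Submission
  imports Defs
begin

text \<open>
  Write \<open>B = g\<^sup>n\<close> with \<open>g = b\<^sub>1 b\<^sub>2\<close> of degree 2, and \<open>c = g(b)\<close>. As \<open>b\<close> is a critical point of \<open>g\<close>,
  reflection in the unit circle gives \<open>(g - c) / (1 - cnj c g) = \<kappa> u\<^sup>2\<close> with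
  \<open>u = (z - b) / (1 - cnj b z)\<close> and \<open>\<bar>\<kappa>\<bar> = 1\<close>. The critical values \<open>c\<close> and \<open>1 / cnj c\<close> of \<open>g\<close>
  both lie on the ray from 0 through \<open>c\<close>, and \<open>v \<mapsto> (v - c) / (1 - cnj c v) / c\<close> maps the
  complement of that ray into the complement of \<open>[0, \<infinity>)\<close>, where a square root exists. So on the
  sphere slit along the closed ray from 0 to infinity through \<open>B(b) = c\<^sup>n\<close>, the map \<open>B\<close> has
  \<open>2 n\<close> continuous sections: an \<open>n\<close>-th root followed by a square root and the inverse of \<open>u\<close>. Their
  images are disjoint and cover the preimage of the slit sphere, hence they are its components. The
  curves sweep out the preimage of the ray without infinity, whose closure adds the poles of \<open>B\<close>,
  since \<open>1 / g\<close> is open near them.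
\<close>

section \<open>Topology of the sphere\<close>

text \<open>Homogeneous coordinates \<open>[x : y]\<close> on the sphere. They treat infinity and
  the poles like all other points. The pair (0, 0) has no meaning and falls to \<open>None\<close>,
  which is why later lemmas ask for a nonzero coordinate.\<close>

definition sphere_frac :: "complex \<Rightarrow> complex \<Rightarrow> rsphere" where
  "sphere_frac x y = (if y = 0 then None else Some (x / y))"

lemma topspace_riemann_sphere [simp]: "topspace riemann_sphere = UNIV"
  using UNIV_option_conv by (auto simp: riemann_sphere_def)

lemma Hausdorff_riemann_sphere: "Hausdorff_space riemann_sphere"
  unfolding riemann_sphere_def Hausdorff_space_Alexandroff_compactification
  by (simp add: locally_compact_space_euclidean)

lemma open_vimage_Some: "openin riemann_sphere V \<Longrightarrow> open {z. Some z \<in> V}"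
  using openin_continuous_map_preimage[OF continuous_map_Some, of euclidean V]
  by (simp add: riemann_sphere_def)

lemma sphere_frac_Some: "sphere_frac z 1 = Some z"
  by (simp add: sphere_frac_def)

lemma sphere_inversion_Some: "sphere_inversion (Some z) = sphere_frac 1 z"
  by (auto simp: sphere_inversion_def sphere_frac_def)

lemma sphere_frac_cases:
  obtains x y where "p = sphere_frac x y" "x \<noteq> 0 \<or> y \<noteq> 0"
proof (cases p)
  case None
  then show ?thesis using that[of 1 0] by (simp add: sphere_frac_def)
next
  case (Some z)
  then show ?thesis using that[of z 1] by (simp add: sphere_frac_def)
qed

lemma sphere_frac_eq_iff:
  assumes "x \<noteq> 0 \<or> y \<noteq> 0" "x' \<noteq> 0 \<or> y' \<noteq> 0"
  shows "sphere_frac x y = sphere_frac x' y' \<longleftrightarrow> x * y' = x' * y"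
  using assms by (auto simp: sphere_frac_def field_simps)

text \<open>Away from 0 this is continuity of \<open>1 / z\<close>. At 0 it uses that the complement
  of a neighbourhood of infinity is compact, hence bounded by some \<open>M\<close>, so that the
  neighbourhood contains \<open>1 / z\<close> whenever \<open>norm z < 1 / M\<close>.\<close>

lemma open_vimage_inversion:
  assumes V: "openin riemann_sphere V"
  shows "open {z. sphere_frac 1 z \<in> V}"
proof -
  have *: "open {z. z \<noteq> 0 \<and> Some (1 / z) \<in> V}"
  proof -
    have "continuous_on (- {0::complex}) (\<lambda>z. 1 / z)"
      by (intro continuous_intros) auto
    then have "open ((\<lambda>z. 1 / z) -` {z. Some z \<in> V} \<inter> - {0})"
      using iffD1[OF continuous_on_open_vimage, rule_format, OF _ _ open_vimage_Some[OF V]] by blast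
    moreover have "(\<lambda>z. 1 / z) -` {z. Some z \<in> V} \<inter> - {0} = {z. z \<noteq> 0 \<and> Some (1 / z) \<in> V}"
      by auto
    ultimately show ?thesis by simp
  qed
  show ?thesis
  proof (cases "None \<in> V")
    case True
    then obtain C where C: "compact C" "V = insert None (Some ` (- C))"
      using V unfolding riemann_sphere_def openin_Alexandroff_compactification
      by (auto simp: Compl_eq_Diff_UNIV)
    obtain M where M: "M > 0" "\<And>z. z \<in> C \<Longrightarrow> norm z \<le> M"
      using compact_imp_bounded[OF C(1)] bounded_pos by metis
    have near: "sphere_frac 1 z \<in> V" if "norm z < 1 / M" for z
    proof (cases "z = 0")
      case False
      then have "norm (1 / z) > M"
        using that M(1) by (simp add: norm_divide field_simps)
      then show ?thesis using False M(2) C(2) by (force simp: sphere_frac_def)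
    qed (use True in \<open>simp add: sphere_frac_def\<close>)
    have "z \<in> {z. sphere_frac 1 z \<in> V} \<longleftrightarrow>
        z \<in> ball 0 (1 / M) \<union> {z. z \<noteq> 0 \<and> Some (1 / z) \<in> V}" for z
      using M(1) near[of z] by (cases "z = 0") (auto simp: sphere_frac_def)
    then have "{z. sphere_frac 1 z \<in> V} = ball 0 (1 / M) \<union> {z. z \<noteq> 0 \<and> Some (1 / z) \<in> V}"
      by blast
    then show ?thesis using * by auto
  next
    case False
    then have "{z. sphere_frac 1 z \<in> V} = {z. z \<noteq> 0 \<and> Some (1 / z) \<in> V}"
      by (auto simp: sphere_frac_def split: if_splits)
    then show ?thesis using * by simp
  qed
qed

text \<open>If infinity lies in \<open>V\<close>, a small disc about 0 in the chart at infinity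
  keeps the finite points outside \<open>V\<close> bounded; being closed as well, they form a
  compact set.\<close>

lemma openin_riemann_sphere_charts:
  assumes "open {z. Some z \<in> V}" "open {z. sphere_frac 1 z \<in> V}"
  shows "openin riemann_sphere V"
proof (cases "None \<in> V")
  case False
  have "p \<in> V \<longleftrightarrow> p \<in> Some ` {z. Some z \<in> V}" for p
    using False by (cases p) auto
  then have "V = Some ` {z. Some z \<in> V}" by blast
  then show ?thesis
    using assms(1) by (metis openin_Alexandroff_compactification_image_Some open_openin riemann_sphere_def)
next
  case True
  define C where "C = {z. Some z \<notin> V}"
  have "closed C"
    using assms(1) unfolding C_def closed_def by (simp add: Collect_neg_eq[symmetric])
  have "0 \<in> {z. sphere_frac 1 z \<in> V}" using True by (simp add: sphere_frac_def)
  then obtain e where e: "e > 0" "\<And>z. norm z < e \<Longrightarrow> sphere_frac 1 z \<in> V"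
    using assms(2) unfolding open_contains_ball by (auto simp: subset_iff)
  have "norm z \<le> 1 / e" if "z \<in> C" for z
  proof (rule ccontr)
    assume *: "\<not> norm z \<le> 1 / e"
    then have z: "z \<noteq> 0" using e(1) by auto
    then have "norm (1 / z) < e"
      using * e(1) by (simp add: norm_divide field_simps)
    from e(2)[OF this] show False using that z by (simp add: C_def sphere_frac_def)
  qed
  then have "bounded C" by (auto simp: bounded_iff)
  with \<open>closed C\<close> have "compact C" by (simp add: compact_eq_bounded_closed)
  moreover have "p \<in> V \<longleftrightarrow> p \<in> insert None (Some ` (- C))" for p
    using True by (cases p) (auto simp: C_def)
  then have "V = insert None (Some ` (- C))" by blast
  ultimately show ?thesis
    unfolding riemann_sphere_def openin_Alexandroff_compactification
    using \<open>closed C\<close> by (intro disjI2 exI[of _ C]) (simp add: Compl_eq_Diff_UNIV)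
qed

text \<open>Where \<open>g\<close> is nonzero the chart value is \<open>f / g\<close>, where
  \<open>f\<close> is nonzero the value in the chart at infinity is \<open>g / f\<close>. Each gives
  a relatively open part of the preimage, and the two parts cover it.\<close>

lemma continuous_map_sphere_frac:
  fixes f g :: "'a::topological_space \<Rightarrow> complex"
  assumes f: "continuous_on S f" and g: "continuous_on S g"
    and nz: "\<And>x. x \<in> S \<Longrightarrow> f x \<noteq> 0 \<or> g x \<noteq> 0"
  shows "continuous_map (top_of_set S) riemann_sphere (\<lambda>x. sphere_frac (f x) (g x))"
proof -
  have "openin (top_of_set S) {x \<in> S. sphere_frac (f x) (g x) \<in> V}"
    if V: "openin riemann_sphere V" for V
  proof -
    have quot: "openin (top_of_set S) {x \<in> S. k x \<noteq> 0 \<and> h x / k x \<in> W}"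
      if h: "continuous_on S h" and k: "continuous_on S k" and W: "open W"
      for h k :: "'a \<Rightarrow> complex" and W
    proof -
      let ?S = "S \<inter> k -` (- {0})"
      have S: "openin (top_of_set S) ?S"
        by (intro continuous_openin_preimage_gen k) auto
      have "continuous_on ?S (\<lambda>x. h x / k x)"
        by (intro continuous_intros continuous_on_subset[OF h] continuous_on_subset[OF k]) auto
      then have "openin (top_of_set ?S) (?S \<inter> (\<lambda>x. h x / k x) -` W)"
        by (intro continuous_openin_preimage_gen W)
      then have "openin (top_of_set S) (?S \<inter> (\<lambda>x. h x / k x) -` W)"
        using S openin_trans by blast
      moreover have "?S \<inter> (\<lambda>x. h x / k x) -` W = {x \<in> S. k x \<noteq> 0 \<and> h x / k x \<in> W}"
        by auto
      ultimately show ?thesis by simp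
    qed
    have "{x \<in> S. sphere_frac (f x) (g x) \<in> V} =
        {x \<in> S. g x \<noteq> 0 \<and> f x / g x \<in> {z. Some z \<in> V}} \<union>
        {x \<in> S. f x \<noteq> 0 \<and> g x / f x \<in> {z. sphere_frac 1 z \<in> V}}"
      using nz by (auto simp: sphere_frac_def split: if_splits)
    then show ?thesis
      using quot[OF f g open_vimage_Some[OF V]] quot[OF g f open_vimage_inversion[OF V]] by auto
  qed
  then show ?thesis by (auto simp: continuous_map_def)
qed

lemma continuous_map_riemann_sphere_charts:
  assumes "continuous_map euclidean Y (\<lambda>z. F (Some z))"
    and "continuous_map euclidean Y (\<lambda>z. F (sphere_frac 1 z))"
  shows "continuous_map riemann_sphere Y F"
  unfolding continuous_map_def
proof (intro conjI allI impI)
  show "F \<in> topspace riemann_sphere \<rightarrow> topspace Y"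
  proof
    fix p :: rsphere
    show "F p \<in> topspace Y"
    proof (cases p)
      case None
      then have "p = sphere_frac 1 0" by (simp add: sphere_frac_def)
      then show ?thesis using continuous_map_funspace[OF assms(2)] by auto
    qed (use continuous_map_funspace[OF assms(1)] in auto)
  qed
  fix V assume "openin Y V"
  then show "openin riemann_sphere {p \<in> topspace riemann_sphere. F p \<in> V}"
    using openin_continuous_map_preimage[OF assms(1)] openin_continuous_map_preimage[OF assms(2)]
    by (intro openin_riemann_sphere_charts) auto
qed

lemma continuous_map_the:
  "continuous_map (subtopology riemann_sphere (Some ` S)) (top_of_set S) the"
  unfolding continuous_map_def
proof (intro conjI allI impI)
  fix U assume "openin (top_of_set S) U"
  then obtain W where W: "open W" "U = S \<inter> W" by (auto simp: openin_open)
  have "{p \<in> topspace (subtopology riemann_sphere (Some ` S)). the p \<in> U} = Some ` W \<inter> Some ` S"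
    using W(2) by auto
  then show "openin (subtopology riemann_sphere (Some ` S))
      {p \<in> topspace (subtopology riemann_sphere (Some ` S)). the p \<in> U}"
    unfolding openin_subtopology using W(1) by (intro exI[of _ "Some ` W"]) (simp add: riemann_sphere_def)
qed auto

text \<open>The sheets are disjoint, and each is closed because the space is Hausdorff; being finitely
  many, they are also open.\<close>

lemma sheets_of_sections:
  fixes s :: "'i \<Rightarrow> 'b \<Rightarrow> 'a"
  assumes X: "Hausdorff_space X" and F: "continuous_map X Y F" and T: "connectedin Y T" "T \<noteq> {}"
    and I: "finite I"
    and s: "\<And>i. i \<in> I \<Longrightarrow> continuous_map (subtopology Y T) X (s i)"
    and sec: "\<And>i t. \<lbrakk>i \<in> I; t \<in> T\<rbrakk> \<Longrightarrow> F (s i t) = t"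
    and cover: "\<And>p. \<lbrakk>p \<in> topspace X; F p \<in> T\<rbrakk> \<Longrightarrow> \<exists>i\<in>I. s i (F p) = p"
    and disj: "\<And>i j t. \<lbrakk>i \<in> I; j \<in> I; t \<in> T; s i t = s j t\<rbrakk> \<Longrightarrow> i = j"
    and \<Omega>: "\<Omega> \<in> connected_components_of (subtopology X {p \<in> topspace X. F p \<in> T})"
  shows "openin (subtopology X {p \<in> topspace X. F p \<in> T}) \<Omega> \<and> inj_on F \<Omega> \<and> F ` \<Omega> = T"
proof -
  let ?U = "{p \<in> topspace X. F p \<in> T}"
  let ?XU = "subtopology X ?U"
  have TY: "T \<subseteq> topspace Y" using T(1) by (rule connectedin_subset_topspace)
  have sX: "s i t \<in> topspace X" if "i \<in> I" "t \<in> T" for i t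
    using continuous_map_funspace[OF s[OF that(1)]] that(2) TY by auto
  \<comment> \<open>The sheet is the set where \<open>s i\<close> after \<open>F\<close> agrees with
    the identity. Equalizers of continuous maps into a Hausdorff space are closed.\<close>
  have sheet: "s i ` T = {p \<in> ?U. s i (F p) = p}" if "i \<in> I" for i
    using that sec sX by (auto simp: image_iff) metis
  have closed: "closedin ?XU (s i ` T)" if i: "i \<in> I" for i
  proof -
    have "continuous_map ?XU (subtopology Y T) F"
      using continuous_map_from_subtopology[OF F] by (auto simp: continuous_map_in_subtopology)
    then have "continuous_map ?XU X (\<lambda>p. s i (F p))"
      using continuous_map_compose[OF _ s[OF i]] by (auto simp: o_def)
    moreover have "continuous_map ?XU X (\<lambda>p. p)"
      by (simp add: continuous_map_from_subtopology)
    ultimately have "closedin ?XU {p \<in> topspace ?XU. s i (F p) = p}"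
      using X by (intro closedin_continuous_maps_eq)
    then show ?thesis by (simp add: sheet[OF i] Int_absorb1 conj_ac)
  qed
  have conn: "connectedin ?XU (s i ` T)" if i: "i \<in> I" for i
  proof -
    have "connectedin (subtopology Y T) T" using T(1) by (simp add: connectedin_subtopology)
    from connectedin_continuous_map_image[OF s[OF i] this] show ?thesis
      using i sX sec by (auto simp: connectedin_subtopology)
  qed
  have opn: "openin ?XU (s i ` T)" if i: "i \<in> I" for i
  proof -
    have "closedin ?XU (\<Union>j\<in>I - {i}. s j ` T)"
      using I closed by (intro closedin_Union) auto
    moreover have "s i ` T = topspace ?XU - (\<Union>j\<in>I - {i}. s j ` T)"
    proof (intro equalityI subsetI)
      fix p assume "p \<in> s i ` T"
      then show "p \<in> topspace ?XU - (\<Union>j\<in>I - {i}. s j ` T)"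
        using i sX sec disj by (auto simp: image_iff) metis
    next
      fix p assume p: "p \<in> topspace ?XU - (\<Union>j\<in>I - {i}. s j ` T)"
      then obtain j where j: "j \<in> I" "s j (F p) = p" using cover[of p] by auto
      then have "p \<in> s j ` T" using p by (auto intro!: image_eqI)
      then have "j = i" using p j(1) by blast
      with j p show "p \<in> s i ` T" by (auto intro!: image_eqI)
    qed
    ultimately show ?thesis by (simp only: openin_diff openin_topspace)
  qed
  obtain p where p: "p \<in> \<Omega>" using nonempty_connected_components_of[OF \<Omega>] by auto
  then have pU: "p \<in> ?U" using connected_components_of_subset[OF \<Omega>] by auto
  then obtain i where i: "i \<in> I" "s i (F p) = p" using cover[of p] by auto
  then have pi: "p \<in> s i ` T" using pU by (auto intro!: image_eqI)
  \<comment> \<open>A component contains every connected set that it meets, and it cannot be split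
    by a clopen set; so it equals the sheet through \<open>p\<close>.\<close>
  have "s i ` T \<subseteq> \<Omega>"
    using connected_components_of_maximal[OF \<Omega> conn[OF i(1)]] p pi by (auto simp: disjnt_iff)
  moreover have "\<Omega> \<subseteq> s i ` T"
    using connectedin_clopen_cases[OF connectedin_connected_components_of[OF \<Omega>]
        closed[OF i(1)] opn[OF i(1)]] p pi by (auto simp: disjnt_iff)
  ultimately have \<Omega>_eq: "\<Omega> = s i ` T" by auto
  have "inj_on F (s i ` T)"
    by (rule inj_on_inverseI[of _ "s i"]) (auto simp: sec[OF i(1)])
  moreover have "F ` s i ` T = T"
    by (simp add: image_image sec[OF i(1)] cong: image_cong)
  ultimately show ?thesis
    unfolding \<Omega>_eq using opn[OF i(1)] by blast
qed

section \<open>The critical point\<close>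

lemma one_minus_cnj_nz: "norm u < 1 \<Longrightarrow> norm v < 1 \<Longrightarrow> 1 - cnj u * v \<noteq> 0"
  for u v :: complex
proof
  assume "norm u < 1" "norm v < 1" "1 - cnj u * v = 0"
  then have "norm u * norm v < 1" "norm (cnj u * v) = 1"
    using mult_strict_mono[of "norm u" 1 "norm v" 1] by auto
  then show False by (simp add: norm_mult)
qed

locale blaschke_pair =
  fixes n :: nat and a1 a2 b :: complex
  assumes n: "n \<ge> 1"
    and a1: "a1 \<noteq> 0" "norm a1 < 1" and a2: "a2 \<noteq> 0" "norm a2 < 1"
    and b: "norm b < 1" "b \<noteq> a1" "b \<noteq> a2" "deriv (blaschke_prod n a1 a2) b = 0"
begin

definition \<epsilon> :: complex where
  "\<epsilon> = cnj a1 / of_real (norm a1) * (cnj a2 / of_real (norm a2))"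

text \<open>In homogeneous coordinates \<open>z = x / y\<close>, the product \<open>b\<^sub>1 b\<^sub>2\<close> is \<open>num / den\<close>.\<close>

definition num :: "complex \<Rightarrow> complex \<Rightarrow> complex" where
  "num x y = \<epsilon> * (a1 * y - x) * (a2 * y - x)"

definition den :: "complex \<Rightarrow> complex \<Rightarrow> complex" where
  "den x y = (y - cnj a1 * x) * (y - cnj a2 * x)"

definition c :: complex where "c = num b 1 / den b 1"

text \<open>The coefficient of \<open>x\<^sup>2\<close> in
  \<open>num x y - c * den x y\<close>.\<close>

definition \<alpha> :: complex where "\<alpha> = \<epsilon> - c * cnj a1 * cnj a2"

lemma norm_eps: "norm \<epsilon> = 1"
  using a1 a2 by (simp add: \<epsilon>_def norm_mult norm_divide)

lemma eps_cnj: "\<epsilon> * cnj \<epsilon> = 1"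
  using complex_norm_square[of \<epsilon>] norm_eps by simp

lemma eps_nz: "\<epsilon> \<noteq> 0"
  using norm_eps by auto

lemma den_b_nz: "den b 1 \<noteq> 0"
  using one_minus_cnj_nz[OF a1(2) b(1)] one_minus_cnj_nz[OF a2(2) b(1)] by (simp add: den_def)

lemma c_nz: "c \<noteq> 0"
  using den_b_nz b eps_nz by (simp add: c_def num_def)

text \<open>Up to a unimodular constant, \<open>c\<close> is the product of two disc automorphisms
  evaluated at \<open>b\<close>.\<close>

lemma norm_c: "norm c < 1"
proof -
  have 1: "norm ((a - b) / (1 - cnj a * b)) < 1" if "norm a < 1" for a
    using Moebius_function_norm_lt_1[OF that b(1), of 0]
    by (simp add: Moebius_function_simple norm_divide norm_minus_commute)
  have "c = \<epsilon> * ((a1 - b) / (1 - cnj a1 * b) * ((a2 - b) / (1 - cnj a2 * b)))"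
    by (simp add: c_def num_def den_def)
  then have "norm c = norm ((a1 - b) / (1 - cnj a1 * b)) * norm ((a2 - b) / (1 - cnj a2 * b))"
    by (simp only: norm_mult norm_eps mult_1_left)
  also have "\<dots> < 1 * 1"
    by (intro mult_strict_mono 1 a1 a2) auto
  finally show ?thesis by simp
qed

lemma alpha_nz: "\<alpha> \<noteq> 0"
proof
  assume "\<alpha> = 0"
  then have "norm c * (norm a1 * norm a2) = 1"
    using norm_eps by (simp add: \<alpha>_def norm_mult[symmetric] mult.assoc)
      (metis complex_cnj_mult complex_mod_cnj norm_mult)
  moreover have "norm a1 * norm a2 < 1 * 1"
    using a1 a2 by (intro mult_strict_mono) auto
  then have "norm c * (norm a1 * norm a2) < 1 * 1"
    using norm_c by (intro mult_strict_mono) auto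
  ultimately show False by simp
qed

lemma blaschke_prod_eq: "blaschke_prod n a1 a2 z = (num z 1 / den z 1) ^ n"
  by (simp add: blaschke_prod_def blaschke_factor_def num_def den_def \<epsilon>_def power_mult_distrib
      power_divide mult_ac)

lemma blaschke_prod_b: "blaschke_prod n a1 a2 b = c ^ n"
  by (simp add: blaschke_prod_eq c_def)

text \<open>Since \<open>b\<close> is a critical point, the value \<open>c\<close> is taken twice there.\<close>

lemma num_minus_den: "num x y - c * den x y = \<alpha> * (x - b * y)\<^sup>2"
proof -
  define A where "A = \<epsilon> * (2 * b - a1 - a2)"
  define D where "D = 2 * cnj a1 * cnj a2 * b - cnj a1 - cnj a2"
  have 1: "((\<lambda>z. num z 1) has_field_derivative A) (at b)"
    unfolding num_def A_def by (auto intro!: derivative_eq_intros simp: algebra_simps)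
  have 2: "((\<lambda>z. den z 1) has_field_derivative D) (at b)"
    unfolding den_def D_def by (auto intro!: derivative_eq_intros simp: algebra_simps)
  have "((\<lambda>z. (num z 1 / den z 1) ^ n) has_field_derivative
      of_nat n * c ^ (n - 1) * ((A * den b 1 - num b 1 * D) / (den b 1 * den b 1))) (at b)"
    using DERIV_power[OF DERIV_divide[OF 1 2 den_b_nz], of n]
    by (simp add: c_def mult_ac)
  then have "of_nat n * c ^ (n - 1) * ((A * den b 1 - num b 1 * D) / (den b 1 * den b 1)) = 0"
    using b(4) DERIV_imp_deriv by (force simp: blaschke_prod_eq[abs_def])
  \<comment> \<open>The factor \<open>of_nat n * c ^ (n - 1)\<close> cancels; \<open>c\<close> is
    nonzero because \<open>b\<close> differs from \<open>a1\<close> and \<open>a2\<close>.\<close>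
  then have "A * den b 1 = num b 1 * D"
    using n c_nz den_b_nz by simp
  then have AD: "A = c * D" and N: "num b 1 = c * den b 1"
    using den_b_nz by (simp_all add: c_def field_simps)
  \<comment> \<open>Homogenised Taylor expansion at \<open>b\<close> of a polynomial of degree 2.
    The terms of order 0 and 1 are the last two, and both vanish.\<close>
  have "num x y - c * den x y = \<alpha> * (x - b * y)\<^sup>2 + (num b 1 - c * den b 1) * y\<^sup>2
      + (A - c * D) * (x * y - b * y\<^sup>2)"
    by (simp add: num_def den_def A_def D_def \<alpha>_def power2_eq_square algebra_simps)
  then show ?thesis using AD N by simp
qed

text \<open>Reflection in the unit circle takes \<open>[x : y]\<close> to
  \<open>[cnj y : cnj x]\<close> and exchanges \<open>num\<close> and \<open>den\<close> up to
  conjugation and the factor \<open>cnj \<epsilon>\<close>. It turns the double point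
  \<open>b\<close> over \<open>c\<close> into the double point \<open>1 / cnj b\<close> over
  \<open>1 / cnj c\<close>.\<close>

lemma den_minus_num: "den x y - cnj c * num x y = \<epsilon> * cnj \<alpha> * (y - cnj b * x)\<^sup>2"
proof -
  have "cnj (num (cnj y) (cnj x)) = cnj \<epsilon> * den x y"
    by (simp add: num_def den_def algebra_simps)
  moreover have "cnj (den (cnj y) (cnj x)) * (\<epsilon> * cnj \<epsilon>) = cnj \<epsilon> * num x y"
    by (simp add: num_def den_def algebra_simps)
  moreover have "cnj (num (cnj y) (cnj x) - c * den (cnj y) (cnj x)) = cnj \<alpha> * (y - cnj b * x)\<^sup>2"
    by (simp add: num_minus_den)
  ultimately have "cnj \<epsilon> * (den x y - cnj c * num x y) = cnj \<alpha> * (y - cnj b * x)\<^sup>2"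
    by (simp add: eps_cnj algebra_simps)
  then have "(\<epsilon> * cnj \<epsilon>) * (den x y - cnj c * num x y) = \<epsilon> * cnj \<alpha> * (y - cnj b * x)\<^sup>2"
    by (simp add: mult.assoc)
  then show ?thesis by (simp add: eps_cnj)
qed

lemma reflect_nz: "x \<noteq> 0 \<or> y \<noteq> 0 \<Longrightarrow> x = b * y \<Longrightarrow> y - cnj b * x \<noteq> 0"
  using one_minus_cnj_nz[OF b(1) b(1)] by (auto simp: algebra_simps)

text \<open>At a common zero both squares would vanish, and the point would be \<open>b\<close> and
  \<open>1 / cnj b\<close> at once.\<close>

lemma num_den_nz:
  assumes "x \<noteq> 0 \<or> y \<noteq> 0"
  shows "num x y \<noteq> 0 \<or> den x y \<noteq> 0"
proof (rule ccontr)
  assume "\<not> ?thesis"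
  then have "(x - b * y)\<^sup>2 = 0" "(y - cnj b * x)\<^sup>2 = 0"
    using num_minus_den[of x y] den_minus_num[of x y] alpha_nz eps_nz by auto
  then show False using reflect_nz[OF assms] by simp
qed

section \<open>The Blaschke product as a map of the sphere\<close>

abbreviation Bs :: "rsphere \<Rightarrow> rsphere" where "Bs \<equiv> blaschke_sphere n a1 a2"

text \<open>\<open>num\<close> and \<open>den\<close> are homogeneous of degree 2, which settles
  finite points. At infinity the ratio of the leading coefficients is
  \<open>\<epsilon> / (cnj a1 * cnj a2)\<close>, the positive number
  \<open>1 / (norm a1 * norm a2)\<close>.\<close>

lemma Bs_sphere_frac:
  assumes "x \<noteq> 0 \<or> y \<noteq> 0"
  shows "Bs (sphere_frac x y) = sphere_frac (num x y ^ n) (den x y ^ n)"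
proof (cases "y = 0")
  case True
  then have x: "x \<noteq> 0" using assms by simp
  have "num x 0 / den x 0 = of_real (1 / norm a1 * (1 / norm a2))"
    using x a1 a2 by (simp add: num_def den_def \<epsilon>_def field_simps)
  moreover have "den x 0 \<noteq> 0" using x a1 a2 by (simp add: den_def)
  ultimately have "num x 0 ^ n / den x 0 ^ n = of_real ((1 / norm a1) ^ n * (1 / norm a2) ^ n)"
    by (metis of_real_power power_divide power_mult_distrib)
  with \<open>den x 0 \<noteq> 0\<close> show ?thesis
    using True by (simp add: sphere_frac_def blaschke_sphere_def power_divide
        power_mult_distrib)
next
  case False
  have "den x y = y\<^sup>2 * den (x / y) 1" "num x y = y\<^sup>2 * num (x / y) 1"
    using False by (simp_all add: den_def num_def field_simps power2_eq_square)
  moreover have "1 - cnj a1 * (x / y) = 0 \<or> 1 - cnj a2 * (x / y) = 0 \<longleftrightarrow> den (x / y) 1 = 0"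
    by (simp add: den_def)
  ultimately show ?thesis
    using False n
    by (simp add: sphere_frac_def blaschke_sphere_def blaschke_prod_eq power_divide
        power_mult_distrib)
qed

lemma continuous_map_Bs: "continuous_map riemann_sphere riemann_sphere Bs"
proof (rule continuous_map_riemann_sphere_charts)
  have cont: "continuous_on UNIV (\<lambda>z. num z 1 ^ n)" "continuous_on UNIV (\<lambda>z. den z 1 ^ n)"
    "continuous_on UNIV (\<lambda>z. num 1 z ^ n)" "continuous_on UNIV (\<lambda>z. den 1 z ^ n)"
    unfolding num_def den_def by (intro continuous_intros)+
  have "continuous_map (top_of_set UNIV) riemann_sphere (\<lambda>z. sphere_frac (num z 1 ^ n) (den z 1 ^ n))"
    by (intro continuous_map_sphere_frac cont) (use num_den_nz[of _ 1] in auto)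
  then show "continuous_map euclidean riemann_sphere (\<lambda>z. Bs (Some z))"
    using Bs_sphere_frac[of _ 1] by (simp add: sphere_frac_Some)
  have "continuous_map (top_of_set UNIV) riemann_sphere (\<lambda>z. sphere_frac (num 1 z ^ n) (den 1 z ^ n))"
    by (intro continuous_map_sphere_frac cont) (use num_den_nz[of 1] in auto)
  then show "continuous_map euclidean riemann_sphere (\<lambda>z. Bs (sphere_frac 1 z))"
    using Bs_sphere_frac[of 1] by simp
qed

text \<open>With the values 0 and infinity excluded, numerator and denominator vanish nowhere, so
  that the map and its reciprocal are holomorphic in every chart. The exclusion is harmless here,
  since both values lie on the slit.\<close>

lemma sphere_holomorphic_on_Bs:
  assumes op: "openin riemann_sphere \<Omega>" and im: "\<And>p. p \<in> \<Omega> \<Longrightarrow> Bs p \<noteq> None \<and> Bs p \<noteq> Some 0"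
  shows "sphere_holomorphic_on Bs \<Omega>"
  unfolding sphere_holomorphic_on_def
proof (intro conjI ballI op)
  show "continuous_map (subtopology riemann_sphere \<Omega>) riemann_sphere Bs"
    using continuous_map_Bs by (rule continuous_map_from_subtopology)
  have fin: "Bs (sphere_frac x y) = Some ((num x y / den x y) ^ n) \<and> num x y \<noteq> 0 \<and> den x y \<noteq> 0"
    if "sphere_frac x y \<in> \<Omega>" "x \<noteq> 0 \<or> y \<noteq> 0" for x y
    using im[OF that(1)] n unfolding Bs_sphere_frac[OF that(2)]
    by (auto simp: sphere_frac_def power_divide split: if_splits)
  have num_hol: "(\<lambda>z. num z 1) holomorphic_on S" "(\<lambda>z. num 1 z) holomorphic_on S"
    and den_hol: "(\<lambda>z. den z 1) holomorphic_on S" "(\<lambda>z. den 1 z) holomorphic_on S" for S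
    unfolding num_def den_def by (auto intro!: holomorphic_intros)
  fix \<phi> \<psi> :: "rsphere \<Rightarrow> rsphere"
  assume \<phi>: "\<phi> \<in> {id, sphere_inversion}" and \<psi>: "\<psi> \<in> {id, sphere_inversion}"
  define S where "S = {z. \<phi> (Some z) \<in> \<Omega> \<and> \<psi> (Bs (\<phi> (Some z))) \<noteq> None}"
  define N where "N = (if \<phi> = id then (\<lambda>z. num z 1) else (\<lambda>z. num 1 z))"
  define D where "D = (if \<phi> = id then (\<lambda>z. den z 1) else (\<lambda>z. den 1 z))"
  have hol: "N holomorphic_on S" "D holomorphic_on S"
    using num_hol den_hol by (auto simp: N_def D_def)
  have val: "Bs (\<phi> (Some z)) = Some ((N z / D z) ^ n) \<and> N z \<noteq> 0 \<and> D z \<noteq> 0" if "z \<in> S" for z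
    using \<phi> that fin[of z 1] fin[of 1 z]
    by (cases "\<phi> = id") (auto simp: S_def N_def D_def sphere_frac_Some sphere_inversion_Some)
  have "(\<lambda>z. the (\<psi> (Bs (\<phi> (Some z))))) holomorphic_on S"
  proof (cases "\<psi> = id")
    case True
    have "(\<lambda>z. (N z / D z) ^ n) holomorphic_on S"
      using val by (auto intro!: holomorphic_intros hol)
    then show ?thesis
      by (rule holomorphic_transform) (simp add: True val)
  next
    case False
    have "(\<lambda>z. 1 / (N z / D z) ^ n) holomorphic_on S"
      using val by (auto intro!: holomorphic_intros hol)
    then show ?thesis
      by (rule holomorphic_transform) (use False \<psi> val in \<open>auto simp: sphere_inversion_def\<close>)
  qed
  then show "(\<lambda>z. the (\<psi> (Bs (\<phi> (Some z))))) holomorphic_on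
      {z. \<phi> (Some z) \<in> \<Omega> \<and> \<psi> (Bs (\<phi> (Some z))) \<noteq> None}"
    by (simp only: S_def)
qed

section \<open>Inverse branches\<close>

definition ray :: "complex set" where "ray = (\<lambda>s. of_real s * c ^ n) ` {0..}"

definition slit :: "rsphere set" where "slit = insert None (Some ` ray)"

lemma rayI: "s \<ge> 0 \<Longrightarrow> of_real s * c ^ n \<in> ray"
  by (auto simp: ray_def)

text \<open>Expressed by the closed negative axis, which is the cut of \<open>Ln\<close>, so that
  continuity of the root branches off the ray follows directly.\<close>

lemma ray_iff: "w \<in> ray \<longleftrightarrow> - w / c ^ n \<in> \<real>\<^sub>\<le>\<^sub>0"
proof -
  have "w \<in> ray \<longleftrightarrow> (\<exists>s\<ge>0. w / c ^ n = of_real s)"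
    using c_nz by (auto simp: ray_def image_iff field_simps)
  also have "\<dots> \<longleftrightarrow> w / c ^ n \<in> \<real>\<^sub>\<ge>\<^sub>0"
    by (auto simp: nonneg_Reals_def)
  finally show ?thesis by simp
qed

lemma Compl_slit: "- slit = Some ` (- ray)"
proof -
  have "p \<in> - slit \<longleftrightarrow> p \<in> Some ` (- ray)" for p
    by (cases p) (auto simp: slit_def)
  then show ?thesis by blast
qed

lemma closed_ray: "closed ray"
proof -
  have "closed ((\<lambda>w. - w / c ^ n) -` \<real>\<^sub>\<le>\<^sub>0)"
    using c_nz by (intro closed_vimage closed_nonpos_Reals_complex continuous_intros) auto
  moreover have "ray = (\<lambda>w. - w / c ^ n) -` \<real>\<^sub>\<le>\<^sub>0"
    by (auto simp: ray_iff)
  ultimately show ?thesis by simp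
qed

lemma openin_Compl_slit: "openin riemann_sphere (- slit)"
  using closed_ray by (simp add: Compl_slit riemann_sphere_def open_Compl)

text \<open>The plane cut along the closed negative axis is starlike, and \<open>- z * c ^ n\<close>
  carries it onto the complement of the ray.\<close>

lemma connectedin_Compl_slit: "connectedin riemann_sphere (- slit)"
proof -
  have "connected (- (complex_of_real ` {..0}))"
    using starlike_slotted_complex_plane_left starlike_imp_connected by blast
  then have "connected ((\<lambda>z. - z * c ^ n) ` (- (complex_of_real ` {..0})))"
    by (intro connected_continuous_image continuous_intros)
  moreover have "w \<in> (\<lambda>z. - z * c ^ n) ` (- (complex_of_real ` {..0})) \<longleftrightarrow> w \<in> - ray" for w
  proof -
    have nonpos: "\<real>\<^sub>\<le>\<^sub>0 = complex_of_real ` {..0}" by (auto simp: nonpos_Reals_def)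
    have "w \<in> (\<lambda>z. - z * c ^ n) ` A \<longleftrightarrow> - w / c ^ n \<in> A" for A
    proof
      assume "- w / c ^ n \<in> A"
      moreover have "w = - (- w / c ^ n) * c ^ n" using c_nz by simp
      ultimately show "w \<in> (\<lambda>z. - z * c ^ n) ` A" by blast
    qed (use c_nz in auto)
    then show ?thesis by (simp only: Compl_iff ray_iff nonpos)
  qed
  then have "(\<lambda>z. - z * c ^ n) ` (- (complex_of_real ` {..0})) = - ray" by blast
  ultimately have "connectedin euclidean (- ray)" by simp
  then show ?thesis
    unfolding Compl_slit riemann_sphere_def
    by (rule connectedin_continuous_map_image[OF continuous_map_Some])
qed

lemma Compl_slit_nonempty: "- slit \<noteq> {}"
proof -
  have "- (c ^ n) \<notin> ray" using c_nz by (simp add: ray_iff)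
  then show ?thesis by (auto simp: Compl_slit)
qed

lemma sphere_arc_slit: "sphere_arc slit"
proof -
  \<comment> \<open>The slit as a projective segment from 0 to infinity. The finite point at time
    \<open>t\<close> is \<open>t / (1 - t)\<close> times \<open>c ^ n\<close>, and
    \<open>s / (1 + s)\<close> inverts this parameter. Injectivity suffices for an embedding, as the
    interval is compact and the sphere Hausdorff.\<close>
  define g where "g = (\<lambda>t. sphere_frac (of_real t * c ^ n) (of_real (1 - t)))"
  have nz: "of_real t * c ^ n \<noteq> 0 \<or> complex_of_real (1 - t) \<noteq> 0" for t
    using c_nz by auto
  have "continuous_map (top_of_set {0..1}) riemann_sphere g"
    unfolding g_def by (intro continuous_map_sphere_frac nz continuous_intros)
  moreover have "inj_on g {0..1}"
  proof (rule inj_onI)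
    fix s t assume "g s = g t"
    then have "of_real s * c ^ n * of_real (1 - t) = of_real t * c ^ n * of_real (1 - s)"
      unfolding g_def by (subst (asm) sphere_frac_eq_iff) (use nz in auto)
    then have "complex_of_real (s * (1 - t)) * c ^ n = complex_of_real (t * (1 - s)) * c ^ n"
      by (simp add: mult_ac)
    then have "s * (1 - t) = t * (1 - s)"
      using c_nz by (metis mult_cancel_right of_real_eq_iff power_not_zero)
    then show "s = t" by (simp add: algebra_simps)
  qed
  ultimately have "embedding_map (top_of_set {0..1}) riemann_sphere g"
    by (intro continuous_imp_embedding_map Hausdorff_riemann_sphere)
      (auto simp: compact_space_subtopology)
  moreover have "g ` {0..1} = slit"
  proof (intro equalityI subsetI)
    fix p assume "p \<in> g ` {0..1}"
    then obtain t where t: "0 \<le> t" "t \<le> 1" "p = g t" by auto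
    show "p \<in> slit"
    proof (cases "t = 1")
      case False
      then have "p = Some (of_real (t / (1 - t)) * c ^ n)"
        using t by (simp add: g_def sphere_frac_def)
      moreover have "of_real (t / (1 - t)) * c ^ n \<in> ray"
        using t by (intro rayI) auto
      ultimately show ?thesis unfolding slit_def by blast
    qed (use t in \<open>simp add: g_def sphere_frac_def slit_def\<close>)
  next
    fix p assume "p \<in> slit"
    then consider "p = None" | s where "s \<ge> 0" "p = Some (of_real s * c ^ n)"
      by (auto simp: slit_def ray_def)
    then show "p \<in> g ` {0..1}"
    proof cases
      case 1
      then have "p = g 1" by (simp add: g_def sphere_frac_def)
      then show ?thesis by simp
    next
      case 2
      then have "1 - s / (1 + s) = 1 / (1 + s)" "1 + s \<noteq> 0" by (simp_all add: field_simps)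
      then have "g (s / (1 + s)) = sphere_frac (of_real s * c ^ n) 1"
        unfolding g_def by (subst sphere_frac_eq_iff) (simp_all del: of_real_add)
      then have "p = g (s / (1 + s))" using 2(2) by (simp add: sphere_frac_Some)
      then show ?thesis using 2(1) by simp
    qed
  qed
  ultimately show ?thesis unfolding sphere_arc_def by blast
qed

text \<open>The sign inside \<open>Ln\<close> moves its cut onto the ray, and
  \<open>cis (pi / real n)\<close>, an \<open>n\<close>-th root of -1, makes up for that sign. The
  root of unity \<open>\<zeta>\<close> selects the branch.\<close>

definition nth_branch :: "complex \<Rightarrow> complex \<Rightarrow> complex" where
  "nth_branch \<zeta> w = \<zeta> * (c * cis (pi / real n) * exp (Ln (- w / c ^ n) / of_nat n))"

lemma nth_branch_power:
  assumes "\<zeta> ^ n = 1" "w \<notin> ray"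
  shows "nth_branch \<zeta> w ^ n = w"
proof -
  have "w \<noteq> 0" using assms(2) by (auto simp: ray_iff)
  then have "exp (Ln (- w / c ^ n) / of_nat n) ^ n = - w / c ^ n"
    using n c_nz by (simp flip: exp_of_nat_mult)
  moreover have "cis (pi / real n) ^ n = -1" using n by (simp add: Complex.DeMoivre)
  ultimately show ?thesis
    using c_nz assms(1) by (simp add: nth_branch_def power_mult_distrib)
qed

lemma nth_branch_nz: "nth_branch 1 w \<noteq> 0"
  using c_nz by (simp add: nth_branch_def cis_neq_zero)

text \<open>The Moebius map that sends the two critical values \<open>c\<close> and
  \<open>1 / cnj c\<close> of \<open>num / den\<close> to 0 and infinity.\<close>

definition moeb :: "complex \<Rightarrow> complex" where "moeb v = (v - c) / (1 - cnj c * v)"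

text \<open>A value of \<open>moeb v / c\<close> in \<open>[0, \<infinity>)\<close> would put \<open>v\<close> on the ray through \<open>c\<close>.\<close>

lemma moeb_slit:
  assumes "v ^ n \<notin> ray"
  shows "1 - cnj c * v \<noteq> 0" "- moeb v / c \<notin> \<real>\<^sub>\<le>\<^sub>0"
proof -
  have v: "v \<noteq> of_real s * c" if "s \<ge> 0" for s
  proof
    assume "v = of_real s * c"
    then have "v ^ n = of_real (s ^ n) * c ^ n" by (simp add: power_mult_distrib)
    then show False using assms rayI[of "s ^ n"] that by (simp only: zero_le_power not_True_eq_False)
  qed
  have cc: "cnj c * c = of_real ((norm c)\<^sup>2)"
    using complex_norm_square[of c] by (simp add: mult.commute)
  show 1: "1 - cnj c * v \<noteq> 0"
  proof
    assume "1 - cnj c * v = 0"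
    then have "c = (cnj c * c) * v" by (simp add: algebra_simps)
    then have "v = of_real (1 / (norm c)\<^sup>2) * c" using c_nz unfolding cc by (simp add: field_simps)
    then show False using v[of "1 / (norm c)\<^sup>2"] by simp
  qed
  show "- moeb v / c \<notin> \<real>\<^sub>\<le>\<^sub>0"
  proof
    assume "- moeb v / c \<in> \<real>\<^sub>\<le>\<^sub>0"
    then have "moeb v / c \<in> \<real>\<^sub>\<ge>\<^sub>0" by simp
    then obtain s where s: "s \<ge> 0" "moeb v / c = of_real s"
      by (auto simp: nonneg_Reals_def)
    then have "v - c = of_real s * c * (1 - cnj c * v)"
      using 1 c_nz by (simp add: moeb_def field_simps)
    \<comment> \<open>Solving the Moebius equation for \<open>v\<close>: since
      \<open>cnj c * c\<close> is real and nonnegative, \<open>v\<close> is a positive multiple of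
      \<open>c\<close>.\<close>
    then have "v * (1 + of_real s * (cnj c * c)) = of_real (1 + s) * c"
      by (simp add: algebra_simps)
    then have *: "v * of_real (1 + s * (norm c)\<^sup>2) = of_real (1 + s) * c"
      unfolding cc by simp
    have pos: "1 + s * (norm c)\<^sup>2 > 0" using s(1) by (intro add_pos_nonneg) auto
    then have "v = of_real ((1 + s) / (1 + s * (norm c)\<^sup>2)) * c"
      using * unfolding of_real_divide times_divide_eq_left by (intro eq_divide_imp) (auto simp del: of_real_add)
    then show False using v[of "(1 + s) / (1 + s * (norm c)\<^sup>2)"] s(1) pos by simp
  qed
qed

text \<open>A solution \<open>u\<close> of
  \<open>\<alpha> * u\<^sup>2 = \<epsilon> * cnj \<alpha> * moeb v\<close>. The root is split into a
  constant one and the root of \<open>- moeb v / c\<close>, because the latter argument avoids the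
  cut of \<open>csqrt\<close>. The sign is \<open>\<sigma>\<close>.\<close>

definition sqrt_branch :: "complex \<Rightarrow> complex \<Rightarrow> complex" where
  "sqrt_branch \<sigma> v = \<sigma> * (csqrt (- c * \<epsilon> * cnj \<alpha> / \<alpha>) * csqrt (- moeb v / c))"

lemma sqrt_branch_square: "\<sigma>\<^sup>2 = 1 \<Longrightarrow> \<alpha> * (sqrt_branch \<sigma> v)\<^sup>2 = \<epsilon> * cnj \<alpha> * moeb v"
  using c_nz alpha_nz by (simp add: sqrt_branch_def power_mult_distrib)

lemma sqrt_branch_nz: "v ^ n \<notin> ray \<Longrightarrow> sqrt_branch 1 v \<noteq> 0"
  using moeb_slit(2)[of v] c_nz alpha_nz eps_nz by (auto simp: sqrt_branch_def)

text \<open>The last step inverts \<open>u = (z - b) / (1 - cnj b * z)\<close>. Homogeneous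
  coordinates let the branch pass through infinity.\<close>

definition branch :: "complex \<times> complex \<Rightarrow> complex \<Rightarrow> rsphere" where
  "branch i w = (let u = sqrt_branch (snd i) (nth_branch (fst i) w)
     in sphere_frac (u + b) (1 + cnj b * u))"

definition branch_index :: "(complex \<times> complex) set" where
  "branch_index = {\<zeta>. \<zeta> ^ n = 1} \<times> {\<sigma>. \<sigma>\<^sup>2 = 1}"

lemma finite_branch_index: "finite branch_index"
  unfolding branch_index_def using n by (intro finite_cartesian_product finite_roots_unity) auto

lemma branch_pair_nz: "u + b \<noteq> 0 \<or> 1 + cnj b * u \<noteq> 0"
proof (rule ccontr)
  assume "\<not> ?thesis"
  then have "u = - b" "1 + cnj b * u = 0" by (auto simp: add_eq_0_iff2)
  then show False using one_minus_cnj_nz[OF b(1) b(1)] by simp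
qed

lemma continuous_map_branch:
  assumes "i \<in> branch_index"
  shows "continuous_map (top_of_set (- ray)) riemann_sphere (branch i)"
proof -
  obtain \<zeta> \<sigma> where i: "i = (\<zeta>, \<sigma>)" "\<zeta> ^ n = 1" using assms by (auto simp: branch_index_def)
  have v: "continuous_on (- ray) (nth_branch \<zeta>)"
    unfolding nth_branch_def using c_nz n
    by (intro continuous_intros) (auto simp: ray_iff)
  have "continuous_on (- ray) (\<lambda>w. - moeb (nth_branch \<zeta> w) / c)"
    unfolding moeb_def using moeb_slit(1) c_nz i(2)
    by (intro continuous_intros v) (auto simp: nth_branch_power)
  then have "continuous_on (- ray) (\<lambda>w. csqrt (- moeb (nth_branch \<zeta> w) / c))"
    using moeb_slit(2) i(2)
    by (intro continuous_on_compose2[OF continuous_on_csqrt]) (auto simp: nth_branch_power)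
  then have "continuous_on (- ray) (\<lambda>w. sqrt_branch \<sigma> (nth_branch \<zeta> w))"
    unfolding sqrt_branch_def by (intro continuous_intros)
  then show ?thesis
    unfolding branch_def i Let_def fst_conv snd_conv
    by (intro continuous_map_sphere_frac branch_pair_nz continuous_intros)
qed

text \<open>The two square identities at the branch point show that \<open>num / den\<close> and
  \<open>v\<close> have the same image under \<open>moeb\<close>, which is injective because
  \<open>norm c < 1\<close>.\<close>

lemma Bs_branch:
  assumes "i \<in> branch_index" "w \<notin> ray"
  shows "Bs (branch i w) = Some w"
proof -
  obtain \<zeta> \<sigma> where i: "i = (\<zeta>, \<sigma>)" "\<zeta> ^ n = 1" "\<sigma>\<^sup>2 = 1"
    using assms(1) by (auto simp: branch_index_def)
  define v where "v = nth_branch \<zeta> w"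
  define u where "u = sqrt_branch \<sigma> v"
  let ?N = "num (u + b) (1 + cnj b * u)" and ?D = "den (u + b) (1 + cnj b * u)"
  let ?q = "1 - cnj b * b"
  have vn: "v ^ n = w" unfolding v_def using i(2) assms(2) by (rule nth_branch_power)
  have den: "1 - cnj c * v \<noteq> 0" using moeb_slit(1)[of v] vn assms(2) by simp
  \<comment> \<open>In these coordinates \<open>x - b * y\<close> is \<open>u * ?q\<close> and
    \<open>y - cnj b * x\<close> is \<open>?q\<close>.\<close>
  have 1: "?N - c * ?D = \<alpha> * u\<^sup>2 * ?q\<^sup>2"
    unfolding num_minus_den by (simp add: power2_eq_square algebra_simps)
  have 2: "?D - cnj c * ?N = \<epsilon> * cnj \<alpha> * ?q\<^sup>2"
    unfolding den_minus_num by (simp add: power2_eq_square algebra_simps)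
  have sq: "\<alpha> * u\<^sup>2 = \<epsilon> * cnj \<alpha> * moeb v"
    unfolding u_def by (rule sqrt_branch_square[OF i(3)])
  have "?N - c * ?D = moeb v * (?D - cnj c * ?N)"
    unfolding 1 2 sq by simp
  then have "(?N - c * ?D) * (1 - cnj c * v) = (v - c) * (?D - cnj c * ?N)"
    using den by (simp add: moeb_def)
  then have "(?N - v * ?D) * (1 - cnj c * c) = 0"
    by (simp add: algebra_simps)
  then have N: "?N = v * ?D"
    using one_minus_cnj_nz[OF norm_c norm_c] by simp
  then have "?D \<noteq> 0" using num_den_nz[OF branch_pair_nz[of u]] by auto
  then show ?thesis
    using N vn Bs_sphere_frac[OF branch_pair_nz[of u]]
    by (simp add: branch_def i(1) Let_def u_def v_def sphere_frac_def power_mult_distrib)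
qed

text \<open>The index is read off from the point: \<open>\<zeta>\<close> compares
  \<open>v = num / den\<close> with the branch of the \<open>n\<close>-th root of index 1, and
  \<open>\<sigma>\<close> compares the coordinate \<open>u\<close> with the square root of sign
  1.\<close>

lemma branch_cover:
  assumes "Bs p = Some w" "w \<notin> ray"
  shows "\<exists>i\<in>branch_index. branch i w = p"
proof -
  obtain x y where p: "p = sphere_frac x y" and xy: "x \<noteq> 0 \<or> y \<noteq> 0"
    by (rule sphere_frac_cases)
  define v where "v = num x y / den x y"
  have D: "den x y \<noteq> 0" and vn: "v ^ n = w"
    using assms(1) n unfolding p Bs_sphere_frac[OF xy]
    by (auto simp: sphere_frac_def v_def power_divide split: if_splits)
  have N: "num x y = v * den x y" using D by (simp add: v_def)
  have vslit: "v ^ n \<notin> ray" using assms(2) vn by simp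
  note den = moeb_slit(1)[OF vslit]
  define \<zeta> where "\<zeta> = v / nth_branch 1 w"
  have "\<zeta> ^ n = 1"
    using nth_branch_power[of 1, OF _ assms(2)] vn assms(2)
    by (auto simp: \<zeta>_def power_divide ray_iff)
  have v_branch: "v = nth_branch \<zeta> w"
    using nth_branch_nz[of w] by (simp add: nth_branch_def \<zeta>_def)
  have "(num x y - c * den x y) * (1 - cnj c * v) = (v - c) * (den x y - cnj c * num x y)"
    unfolding N by (simp add: algebra_simps)
  then have *: "\<alpha> * (x - b * y)\<^sup>2 * (1 - cnj c * v) = (v - c) * (\<epsilon> * cnj \<alpha> * (y - cnj b * x)\<^sup>2)"
    unfolding num_minus_den den_minus_num .
  \<comment> \<open>The point is not \<open>1 / cnj b\<close>, so its coordinate \<open>u\<close> is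
    finite.\<close>
  have y: "y - cnj b * x \<noteq> 0"
  proof
    assume y0: "y - cnj b * x = 0"
    then have "x - b * y = 0" using * alpha_nz den by simp
    then show False using reflect_nz[OF xy] y0 by simp
  qed
  define u where "u = (x - b * y) / (y - cnj b * x)"
  have "\<alpha> * u\<^sup>2 = \<epsilon> * cnj \<alpha> * moeb v"
    using * y den by (simp add: u_def moeb_def power_divide field_simps)
  then have sq: "u\<^sup>2 = (sqrt_branch 1 v)\<^sup>2"
    using sqrt_branch_square[of 1 v] alpha_nz by (metis mult_cancel_left one_power2)
  define \<sigma> where "\<sigma> = u / sqrt_branch 1 v"
  have "\<sigma>\<^sup>2 = 1" using sq sqrt_branch_nz[OF vslit] by (simp add: \<sigma>_def power_divide)
  have u_branch: "u = sqrt_branch \<sigma> v"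
    using sqrt_branch_nz[OF vslit] by (simp add: sqrt_branch_def \<sigma>_def)
  have "branch (\<zeta>, \<sigma>) w = sphere_frac (u + b) (1 + cnj b * u)"
    by (simp add: branch_def Let_def u_branch flip: v_branch)
  also have "\<dots> = p"
    unfolding p sphere_frac_eq_iff[OF branch_pair_nz xy]
    using y by (simp add: u_def field_simps)
  finally show ?thesis
    using \<open>\<zeta> ^ n = 1\<close> \<open>\<sigma>\<^sup>2 = 1\<close> by (auto simp: branch_index_def)
qed

text \<open>Every stage can be undone: the point determines \<open>u\<close>, the square of
  \<open>u\<close> determines \<open>moeb v\<close> and so \<open>v\<close>, then \<open>v\<close>
  and \<open>w\<close> determine \<open>\<zeta>\<close>, and \<open>u\<close> and \<open>v\<close>
  determine \<open>\<sigma>\<close>.\<close>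

lemma branch_disjoint:
  assumes i: "i \<in> branch_index" and j: "j \<in> branch_index" and w: "w \<notin> ray"
    and eq: "branch i w = branch j w"
  shows "i = j"
proof -
  obtain \<zeta> \<sigma> where i: "i = (\<zeta>, \<sigma>)" "\<zeta> ^ n = 1" "\<sigma>\<^sup>2 = 1"
    using i by (auto simp: branch_index_def)
  obtain \<zeta>' \<sigma>' where j: "j = (\<zeta>', \<sigma>')" "\<zeta>' ^ n = 1" "\<sigma>'\<^sup>2 = 1"
    using j by (auto simp: branch_index_def)
  define v where "v = nth_branch \<zeta> w"
  define v' where "v' = nth_branch \<zeta>' w"
  define u where "u = sqrt_branch \<sigma> v"
  define u' where "u' = sqrt_branch \<sigma>' v'"
  have slit: "v ^ n \<notin> ray" "v' ^ n \<notin> ray"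
    using nth_branch_power w i(2) j(2) by (simp_all add: v_def v'_def)
  have "(u + b) * (1 + cnj b * u') = (u' + b) * (1 + cnj b * u)"
    using eq branch_pair_nz
    by (simp add: branch_def i(1) j(1) Let_def u_def u'_def v_def v'_def sphere_frac_eq_iff)
  then have "(u - u') * (1 - cnj b * b) = 0" by (simp add: algebra_simps)
  then have u: "u = u'" using one_minus_cnj_nz[OF b(1) b(1)] by simp
  then have "\<epsilon> * cnj \<alpha> * moeb v = \<epsilon> * cnj \<alpha> * moeb v'"
    by (metis sqrt_branch_square i(3) j(3) u_def u'_def)
  then have "moeb v = moeb v'" using eps_nz alpha_nz by simp
  then have "(v - c) * (1 - cnj c * v') = (v' - c) * (1 - cnj c * v)"
    using moeb_slit(1)[OF slit(1)] moeb_slit(1)[OF slit(2)] by (simp add: moeb_def field_simps)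
  then have "(v - v') * (1 - cnj c * c) = 0" by (simp add: algebra_simps)
  then have v: "v = v'" using one_minus_cnj_nz[OF norm_c norm_c] by simp
  then have "\<zeta> * nth_branch 1 w = \<zeta>' * nth_branch 1 w"
    by (simp add: v_def v'_def nth_branch_def)
  then have "\<zeta> = \<zeta>'" using nth_branch_nz by simp
  moreover have "\<sigma> * sqrt_branch 1 v = \<sigma>' * sqrt_branch 1 v"
    using u v by (simp add: u_def u'_def sqrt_branch_def)
  then have "\<sigma> = \<sigma>'" using sqrt_branch_nz[OF slit(1)] by simp
  ultimately show ?thesis by (simp add: i(1) j(1))
qed

section \<open>Components of the preimage of the slit sphere\<close>

lemma fundamental_domain_component:
  assumes "\<Omega> \<in> connected_components_of (subtopology riemann_sphere {p. Bs p \<notin> slit})"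
  shows "fundamental_domain Bs \<Omega>"
proof -
  let ?U = "{p \<in> topspace riemann_sphere. Bs p \<in> - slit}"
  have U: "?U = {p. Bs p \<notin> slit}" by auto
  have "openin (subtopology riemann_sphere ?U) \<Omega> \<and> inj_on Bs \<Omega> \<and> Bs ` \<Omega> = - slit"
  proof (rule sheets_of_sections[where I = branch_index and s = "\<lambda>i p. branch i (the p)" and Y = riemann_sphere])
    fix i assume i: "i \<in> branch_index"
    show "continuous_map (subtopology riemann_sphere (- slit)) riemann_sphere (\<lambda>p. branch i (the p))"
      unfolding Compl_slit
      using continuous_map_compose[OF continuous_map_the continuous_map_branch[OF i]]
      by (simp add: o_def)
  next
    fix i p assume "i \<in> branch_index" "p \<in> - slit"
    then show "Bs (branch i (the p)) = p"
      unfolding Compl_slit by (auto simp: Bs_branch)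
  next
    fix p assume "Bs p \<in> - slit"
    then show "\<exists>i\<in>branch_index. branch i (the (Bs p)) = p"
      unfolding Compl_slit using branch_cover by auto
  next
    fix i j p assume "i \<in> branch_index" "j \<in> branch_index" "p \<in> - slit"
      "branch i (the p) = branch j (the p)"
    then show "i = j"
      unfolding Compl_slit by (auto intro: branch_disjoint)
  next
    show "\<Omega> \<in> connected_components_of (subtopology riemann_sphere ?U)"
      using assms by simp
  qed (fact Hausdorff_riemann_sphere continuous_map_Bs connectedin_Compl_slit Compl_slit_nonempty
      finite_branch_index)+
  then have op: "openin (subtopology riemann_sphere ?U) \<Omega>" and inj: "inj_on Bs \<Omega>"
    and im: "Bs ` \<Omega> = - slit" by auto
  have "openin riemann_sphere ?U"
    by (rule openin_continuous_map_preimage[OF continuous_map_Bs openin_Compl_slit])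
  then have op: "openin riemann_sphere \<Omega>" using op openin_trans_full by blast
  have "connectedin riemann_sphere \<Omega>"
    using connectedin_connected_components_of[OF assms] by (simp add: connectedin_subtopology)
  moreover have "sphere_holomorphic_on Bs \<Omega>"
  proof (rule sphere_holomorphic_on_Bs[OF op])
    fix p assume "p \<in> \<Omega>"
    then have "Bs p \<in> - slit" using im by blast
    moreover have "Some 0 \<in> slit" "None \<in> slit" by (auto simp: slit_def ray_iff)
    ultimately show "Bs p \<noteq> None \<and> Bs p \<noteq> Some 0" by (metis ComplD)
  qed
  ultimately show ?thesis
    unfolding fundamental_domain_def sphere_domain_def
    using nonempty_connected_components_of[OF assms] op inj im sphere_arc_slit
    by (auto simp: Compl_eq_Diff_UNIV)
qed

text \<open>The preimage of the closed slit is closed. Conversely only poles need an argument: near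
  a pole \<open>den / num\<close> is an open map with value 0 there, so it takes the values
  \<open>d / c\<close> for small \<open>d > 0\<close>, and at such points the Blaschke product is on
  the ray.\<close>

lemma closure_of_preimage_ray:
  "riemann_sphere closure_of {p. Bs p \<in> Some ` ray} = {p. Bs p \<in> slit}"
proof
  have "closedin riemann_sphere slit"
    using openin_Compl_slit by (simp add: closedin_def Compl_eq_Diff_UNIV)
  then have "closedin riemann_sphere {p \<in> topspace riemann_sphere. Bs p \<in> slit}"
    by (rule closedin_continuous_map_preimage[OF continuous_map_Bs])
  then show "riemann_sphere closure_of {p. Bs p \<in> Some ` ray} \<subseteq> {p. Bs p \<in> slit}"
    by (intro closure_of_minimal) (auto simp: slit_def)
next
  have sub: "{p. Bs p \<in> Some ` ray} \<subseteq> riemann_sphere closure_of {p. Bs p \<in> Some ` ray}"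
    by (rule closure_of_subset) simp
  have "p \<in> riemann_sphere closure_of {p. Bs p \<in> Some ` ray}" if pole: "Bs p = None" for p
    unfolding in_closure_of
  proof (intro conjI allI impI)
    fix V assume V: "p \<in> V \<and> openin riemann_sphere V"
    obtain z where p: "p = Some z"
      using pole by (cases p) (auto simp: blaschke_sphere_def)
    have dz: "den z 1 = 0"
      using pole Bs_sphere_frac[of z 1] unfolding p
      by (auto simp: sphere_frac_Some sphere_frac_def split: if_splits)
    then have nz: "num z 1 \<noteq> 0" using num_den_nz[of z 1] by auto
    have "open {y. num y 1 \<noteq> 0}"
      unfolding num_def by (intro open_Collect_neq continuous_intros)
    then have "open ({y. Some y \<in> V} \<inter> {y. num y 1 \<noteq> 0})"
      using V open_vimage_Some by blast
    then obtain r where r: "r > 0" "ball z r \<subseteq> {y. Some y \<in> V} \<inter> {y. num y 1 \<noteq> 0}"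
      using V nz p by (metis (mono_tags, lifting) IntI mem_Collect_eq openE)
    define f where "f = (\<lambda>y. den y 1 / num y 1)"
    have hol: "f holomorphic_on ball z r"
      unfolding f_def num_def den_def using r(2)
      by (intro holomorphic_intros) (auto simp: num_def)
    \<comment> \<open>If \<open>f\<close> were constant, all points of the ball would be poles, of
      which there are at most two.\<close>
    have "\<not> f constant_on ball z r"
    proof
      assume "f constant_on ball z r"
      then have "\<forall>y\<in>ball z r. f y = f z" using r(1) by (auto simp: constant_on_def)
      then have "\<forall>y\<in>ball z r. den y 1 = 0" using r(2) dz by (auto simp: f_def)
      moreover have "y = 1 / cnj a1 \<or> y = 1 / cnj a2" if "den y 1 = 0" for y
        using that a1 a2 unfolding den_def mult_eq_0_iff by (auto simp: field_simps)
      ultimately have "ball z r \<subseteq> {1 / cnj a1, 1 / cnj a2}" by blast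
      then have "finite (ball z r)" by (rule finite_subset) simp
      then show False using uncountable_ball[OF r(1), of z] countable_finite by blast
    qed
    then have "open (f ` ball z r)"
      by (intro open_mapping_thm[OF hol]) auto
    moreover have "0 \<in> f ` ball z r"
      using dz r(1) by (auto simp: f_def image_iff intro!: bexI[of _ z])
    ultimately obtain e where e: "e > 0" "ball 0 e \<subseteq> f ` ball z r"
      by (meson openE)
    \<comment> \<open>Chosen so that \<open>d / c\<close> has modulus \<open>e / 2\<close>.\<close>
    define d where "d = e * norm c / 2"
    have d: "d > 0" using e(1) c_nz by (simp add: d_def)
    have "of_real d / c \<in> ball 0 e"
      using e(1) c_nz by (simp add: d_def norm_divide norm_mult)
    then obtain y where y: "y \<in> ball z r" "f y = of_real d / c" using e(2) by force
    have "Some y \<in> V" "num y 1 \<noteq> 0" using y(1) r(2) by auto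
    moreover have "den y 1 \<noteq> 0" using y(2) d c_nz by (auto simp: f_def)
    moreover have "num y 1 / den y 1 = of_real (1 / d) * c"
      using y(2) d c_nz calculation by (simp add: f_def field_simps)
    then have "Bs (Some y) = Some (of_real ((1 / d) ^ n) * c ^ n)"
      using Bs_sphere_frac[of y 1] \<open>den y 1 \<noteq> 0\<close>
      by (simp add: sphere_frac_Some) (simp add: sphere_frac_def flip: power_divide power_mult_distrib)
    then have "Bs (Some y) \<in> Some ` ray"
      using rayI[of "(1 / d) ^ n"] d by (simp only: imageI zero_le_power zero_le_divide_1_iff less_imp_le)
    ultimately show "\<exists>q. q \<in> {p. Bs p \<in> Some ` ray} \<and> q \<in> V" by blast
  qed simp
  then show "{p. Bs p \<in> slit} \<subseteq> riemann_sphere closure_of {p. Bs p \<in> Some ` ray}"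
    using sub by (auto simp: slit_def)
qed

lemma fundamental_domain_bounded_by_preimage_ray:
  assumes "\<Omega> \<in> domains_bounded_by {p. Bs p \<in> Some ` ray}"
  shows "fundamental_domain Bs \<Omega>"
proof (rule fundamental_domain_component)
  have "UNIV - {p. Bs p \<in> slit} = {p. Bs p \<notin> slit}" by auto
  then show "\<Omega> \<in> connected_components_of (subtopology riemann_sphere {p. Bs p \<notin> slit})"
    using assms by (simp add: domains_bounded_by_def closure_of_preimage_ray)
qed

end

section \<open>The curves\<close>

text \<open>For \<open>A\<close> nonzero this is completing the square. For \<open>A = 0\<close> the
  square root \<open>S\<close> is \<open>P\<close> or \<open>- P\<close>: one sign gives infinity
  and the other \<open>C / P\<close>, and infinity is a double root if \<open>P = 0\<close>.\<close>

lemma quadratic_roots_sphere: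
  assumes S: "S\<^sup>2 = P\<^sup>2 - 4 * A * C" and nz: "A \<noteq> 0 \<or> C \<noteq> 0" and xy: "x \<noteq> 0 \<or> y \<noteq> 0"
  defines "pt \<equiv> \<lambda>\<sigma>. if A \<noteq> 0 then Some ((P + \<sigma> * S) / (2 * A))
    else if P - \<sigma> * S = 0 then None else Some (2 * C / (P - \<sigma> * S))"
  shows "sphere_frac x y \<in> {pt 1, pt (-1)} \<longleftrightarrow> A * x\<^sup>2 - P * x * y + C * y\<^sup>2 = 0"
proof (cases "A = 0")
  case False
  show ?thesis
  proof (cases "y = 0")
    case True
    then show ?thesis using False xy by (simp add: sphere_frac_def pt_def)
  next
    case y: False
    have "4 * A * (A * x\<^sup>2 - P * x * y + C * y\<^sup>2) = (2 * A * x - P * y)\<^sup>2 - S\<^sup>2 * y\<^sup>2"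
      unfolding S by (simp add: power2_eq_square algebra_simps)
    also have "\<dots> = (2 * A * x - (P + S) * y) * (2 * A * x - (P - S) * y)"
      by (simp add: power2_eq_square algebra_simps)
    finally have "A * x\<^sup>2 - P * x * y + C * y\<^sup>2 = 0 \<longleftrightarrow>
        2 * A * x = (P + S) * y \<or> 2 * A * x = (P - S) * y"
      using False by (metis (no_types, lifting) eq_iff_diff_eq_0 mult_eq_0_iff zero_neq_numeral)
    moreover have "x / y = q / (2 * A) \<longleftrightarrow> 2 * A * x = q * y" for q
      using False y by (auto simp: field_simps)
    ultimately show ?thesis
      using False y by (simp add: sphere_frac_def pt_def)
  qed
next
  case True
  then have "(S - P) * (S + P) = 0" using S by (simp add: power2_eq_square algebra_simps)
  then have S': "S = P \<or> S = - P" by (auto simp: add_eq_0_iff2)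
  have "A * x\<^sup>2 - P * x * y + C * y\<^sup>2 = y * (C * y - P * x)"
    using True by (simp add: power2_eq_square algebra_simps)
  then show ?thesis
    using S' True nz by (auto simp: sphere_frac_def pt_def field_simps)
qed

text \<open>The right-hand side is the homogeneous form of the equation that the product of the two
  factors equals \<open>w\<close>; it stays valid at infinity and at the poles.\<close>

lemma curve_point_iff:
  assumes r: "0 < r1" "r1 < 1" "0 < r2" "r2 < 1" and xy: "x \<noteq> 0 \<or> y \<noteq> 0"
  shows "sphere_frac x y \<in> {curve_point r1 \<theta>1 r2 \<theta>2 1 w, curve_point r1 \<theta>1 r2 \<theta>2 (- 1) w} \<longleftrightarrow>
    cis (- (\<theta>1 + \<theta>2)) * (of_real r1 * cis \<theta>1 * y - x) * (of_real r2 * cis \<theta>2 * y - x) =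
    w * ((y - of_real r1 * cis (- \<theta>1) * x) * (y - of_real r2 * cis (- \<theta>2) * x))"
proof -
  \<comment> \<open>With the exponentials as indeterminates subject to \<open>E1 * F1 = 1\<close>
    and \<open>E2 * F2 = 1\<close>, the remaining identities are polynomial.\<close>
  define E1 E2 F1 F2 where E: "E1 = cis \<theta>1" "E2 = cis \<theta>2" "F1 = cis (- \<theta>1)" "F2 = cis (- \<theta>2)"
  define R1 R2 where R: "R1 = complex_of_real r1" "R2 = complex_of_real r2"
  have EF: "E1 * F1 = 1" "E2 * F2 = 1" by (simp_all add: E cis_mult)
  have cis: "cis (\<theta>1 + \<theta>2) = E1 * E2" "cis (- (\<theta>1 + \<theta>2)) = F1 * F2"
    by (simp_all add: E cis_mult)
  define A where "A = curve_den r1 r2 w"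
  define P where "P = curve_lin r1 \<theta>1 r2 \<theta>2 w"
  define C where "C = (of_real r1 * of_real r2 - w) * cis (\<theta>1 + \<theta>2)"
  define S where "S = cis (\<theta>1 + \<theta>2) * csqrt (curve_disc r1 \<theta>1 r2 \<theta>2 w)"
  have "S\<^sup>2 = (E1 * E2)\<^sup>2 * (((w * R1 - R2) * F1 - (w * R2 - R1) * F2)\<^sup>2
      + 4 * w * (1 - R1\<^sup>2) * (1 - R2\<^sup>2) * (F1 * F2))"
    unfolding S_def cis power_mult_distrib power2_csqrt curve_disc_def E R ..
  also have "\<dots> = ((w * R1 - R2) * (E1 * F1) * E2 - (w * R2 - R1) * (E2 * F2) * E1)\<^sup>2
      + 4 * w * (1 - R1\<^sup>2) * (1 - R2\<^sup>2) * (E1 * F1) * (E2 * F2) * (E1 * E2)"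
    by (simp add: power2_eq_square algebra_simps)
  also have "\<dots> = P\<^sup>2 - 4 * A * C"
    unfolding EF P_def A_def C_def curve_lin_def curve_den_def cis E(1,2)[symmetric] R[symmetric]
    by (simp add: power2_eq_square algebra_simps)
  finally have S: "S\<^sup>2 = P\<^sup>2 - 4 * A * C" .
  \<comment> \<open>If both vanished, \<open>w\<close> would equal \<open>r1 * r2\<close> and its
    reciprocal, although \<open>r1 * r2 < 1\<close>.\<close>
  have nz: "A \<noteq> 0 \<or> C \<noteq> 0"
  proof (rule ccontr)
    assume "\<not> ?thesis"
    then have "w * (R1 * R2) = 1" "w = R1 * R2"
      by (auto simp: A_def C_def curve_den_def R mult_ac)
    then have "(r1 * r2) * (r1 * r2) = 1"
      unfolding R by (metis of_real_eq_1_iff of_real_mult)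
    moreover have "r1 * r2 < 1 * 1" using r by (intro mult_strict_mono) auto
    then have "(r1 * r2) * (r1 * r2) < 1 * 1" using r by (intro mult_strict_mono) auto
    ultimately show False by simp
  qed
  have "A * x\<^sup>2 - P * x * y + C * y\<^sup>2 =
      (R1 * E1 * y - x) * (R2 * E2 * y - x) - w * ((E1 * y - R1 * x) * (E2 * y - R2 * x))"
    unfolding P_def A_def C_def curve_lin_def curve_den_def cis E(1,2)[symmetric] R[symmetric]
    by (simp add: power2_eq_square algebra_simps)
  also have "\<dots> = (E1 * F1) * (E2 * F2) * ((R1 * E1 * y - x) * (R2 * E2 * y - x))
      - w * ((E1 * y - R1 * (E1 * F1) * x) * (E2 * y - R2 * (E2 * F2) * x))"
    unfolding EF by simp
  also have "\<dots> = (E1 * E2) * (F1 * F2 * (R1 * E1 * y - x) * (R2 * E2 * y - x)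
      - w * ((y - R1 * F1 * x) * (y - R2 * F2 * x)))"
    by (simp add: algebra_simps)
  finally have *: "A * x\<^sup>2 - P * x * y + C * y\<^sup>2 = 0 \<longleftrightarrow>
      F1 * F2 * (R1 * E1 * y - x) * (R2 * E2 * y - x) = w * ((y - R1 * F1 * x) * (y - R2 * F2 * x))"
    using EF by auto
  have "curve_point r1 \<theta>1 r2 \<theta>2 \<sigma> w = (if A \<noteq> 0 then Some ((P + \<sigma> * S) / (2 * A))
      else if P - \<sigma> * S = 0 then None else Some (2 * C / (P - \<sigma> * S)))" for \<sigma>
    unfolding curve_point_def Let_def A_def P_def C_def S_def ..
  then show ?thesis
    using quadratic_roots_sphere[OF S nz xy] * unfolding cis(2) E R by simp
qed

text \<open>Taking \<open>n\<close>-th roots on the ray: \<open>lam\<close> has the direction of an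
  \<open>n\<close>-th root of \<open>c ^ n\<close>, so \<open>s * c ^ n\<close> is the
  \<open>n\<close>-th power of \<open>lam * t\<close> with \<open>t = root n s * norm c\<close>, and
  \<open>num / den\<close> differs from \<open>lam * t\<close> by a root of unity.\<close>

lemma (in blaschke_pair) Bs_in_ray_iff:
  assumes xy: "x \<noteq> 0 \<or> y \<noteq> 0" and lam: "of_real (norm c) ^ n * lam ^ n = c ^ n"
  shows "Bs (sphere_frac x y) \<in> Some ` ray \<longleftrightarrow>
    (\<exists>k<n. \<exists>t\<ge>0. num x y = cis (2 * pi * real k / real n) * lam * of_real t * den x y)"
proof
  have lam_nz: "lam \<noteq> 0" using lam c_nz n by (auto simp: power_0_left)
  assume "Bs (sphere_frac x y) \<in> Some ` ray"
  then obtain s where D: "den x y \<noteq> 0" and s: "s \<ge> 0" "(num x y / den x y) ^ n = of_real s * c ^ n"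
    unfolding Bs_sphere_frac[OF xy] using n
    by (auto simp: sphere_frac_def ray_def power_divide split: if_splits)
  define t where "t = root n s * norm c"
  have t: "t \<ge> 0" using n s(1) by (simp add: t_def)
  have "t ^ n = s * norm c ^ n"
    using n s(1) by (simp add: t_def power_mult_distrib real_root_pow_pos2)
  then have eq: "(num x y / den x y) ^ n = (lam * of_real t) ^ n"
    unfolding s(2) lam[symmetric] power_mult_distrib
    by (simp add: mult_ac flip: of_real_power)
  show "\<exists>k<n. \<exists>t\<ge>0. num x y = cis (2 * pi * real k / real n) * lam * of_real t * den x y"
  \<comment> \<open>At \<open>t = 0\<close> no quotient determines a root of unity; all curves start
    at the zeros, and \<open>k = 0\<close> serves.\<close>
  proof (cases "t = 0")
    case True
    then have "num x y = 0" using eq n D by (simp add: power_0_left)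
    then show ?thesis using n by (intro exI[of _ 0]) auto
  next
    case False
    define \<zeta> where "\<zeta> = num x y / den x y / (lam * of_real t)"
    have "\<zeta> ^ n = (num x y / den x y) ^ n / (lam * of_real t) ^ n"
      unfolding \<zeta>_def by (rule power_divide)
    also have "\<dots> = 1" using False lam_nz unfolding eq by simp
    finally have "\<zeta> ^ n = 1" .
    then have "\<zeta> \<in> (\<lambda>k. cis (2 * pi * real k / real n)) ` {..<n}"
      using Complex.bij_betw_roots_unity[of n] n by (auto simp: bij_betw_def)
    then obtain k where k: "k < n" "\<zeta> = cis (2 * pi * real k / real n)" by auto
    have "num x y = \<zeta> * lam * of_real t * den x y"
      using D False lam_nz by (simp add: \<zeta>_def)
    then show ?thesis using k t by auto
  qed
next
  assume "\<exists>k<n. \<exists>t\<ge>0. num x y = cis (2 * pi * real k / real n) * lam * of_real t * den x y"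
  then obtain k t where k: "k < n" "t \<ge> 0"
    and eq: "num x y = cis (2 * pi * real k / real n) * lam * of_real t * den x y" by blast
  have D: "den x y \<noteq> 0" using eq num_den_nz[OF xy] by auto
  have "cis (2 * pi * real k / real n) ^ n = 1"
    using Complex.bij_betw_roots_unity[of n] n k(1) by (auto simp: bij_betw_def)
  then have "(num x y / den x y) ^ n = lam ^ n * of_real (t ^ n)"
    using D unfolding eq by (simp add: power_mult_distrib)
  also have "\<dots> = of_real (t ^ n / norm c ^ n) * c ^ n"
    using c_nz by (simp add: lam[symmetric])
  finally have "Bs (sphere_frac x y) = Some (of_real (t ^ n / norm c ^ n) * c ^ n)"
    using D unfolding Bs_sphere_frac[OF xy] by (simp add: sphere_frac_def power_divide)
  moreover have "of_real (t ^ n / norm c ^ n) * c ^ n \<in> ray"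
    using k(2) by (intro rayI) auto
  ultimately show "Bs (sphere_frac x y) \<in> Some ` ray" by (simp only: imageI)
qed

theorem theorem2p1:
  fixes n :: nat and r1 r2 \<theta>1 \<theta>2 \<beta> :: real
    and a1 a2 b lam :: complex and \<omega> :: "nat \<Rightarrow> complex"
    and z1 z2 :: "nat \<Rightarrow> real \<Rightarrow> rsphere"
  assumes "n \<ge> 1"
    and "0 < r1" "r1 < 1" "0 < r2" "r2 < 1"
    and "a1 = of_real r1 * cis \<theta>1" "a2 = of_real r2 * cis \<theta>2" "a1 \<noteq> a2"
    and "norm b < 1" "b \<noteq> a1" "b \<noteq> a2" "deriv (blaschke_prod n a1 a2) b = 0"
    and "is_Arg (blaschke_prod n a1 a2 b) \<beta>"
    and "lam = cis (\<beta> / real n)"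
    and "\<And>k. \<omega> k = cis (2 * pi * real k / real n)"
    and "\<And>k t. z1 k t = curve_point r1 \<theta>1 r2 \<theta>2 1 (\<omega> k * lam * of_real t)"
    and "\<And>k t. z2 k t = curve_point r1 \<theta>1 r2 \<theta>2 (-1) (\<omega> k * lam * of_real t)"
  shows "\<forall>\<Omega> \<in> domains_bounded_by (\<Union>k<n. z1 k ` {0..} \<union> z2 k ` {0..}).
           fundamental_domain (blaschke_sphere n a1 a2) \<Omega>"
proof -
  note r = assms(2-5) and a = assms(6,7) and \<omega> = assms(15) and z = assms(16,17)
  have norm_a: "norm a1 = r1" "norm a2 = r2" using r by (simp_all add: a norm_mult)
  interpret blaschke_pair n a1 a2 b
    using assms(1,9-12) r norm_a by unfold_locales auto
  have cnj_a: "cnj a1 = of_real r1 * cis (- \<theta>1)" "cnj a2 = of_real r2 * cis (- \<theta>2)"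
    by (simp_all add: a cis_cnj)
  have "\<epsilon> = cis (- (\<theta>1 + \<theta>2))"
    unfolding \<epsilon>_def norm_a cnj_a using r by (simp add: cis_mult)
  \<comment> \<open>With this value of \<open>\<epsilon>\<close>, the equation of
    \<open>curve_point_iff\<close> becomes \<open>num x y = w * den x y\<close>.\<close>
  then have curve: "sphere_frac x y \<in> {z1 k t, z2 k t} \<longleftrightarrow> num x y = \<omega> k * lam * of_real t * den x y"
    if "x \<noteq> 0 \<or> y \<noteq> 0" for x y k t
    unfolding z curve_point_iff[OF r that] num_def den_def cnj_a by (simp add: a)
  have "lam ^ n = cis \<beta>"
    using assms(1,14) by (simp add: Complex.DeMoivre)
  \<comment> \<open>The polar form of \<open>c ^ n\<close>, which is the value at \<open>b\<close>
    and has argument \<open>\<beta>\<close>.\<close>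
  then have lam: "of_real (norm c) ^ n * lam ^ n = c ^ n"
    using assms(13) by (simp add: is_Arg_def blaschke_prod_b norm_power cis_conv_exp)
  have "p \<in> (\<Union>k<n. z1 k ` {0..} \<union> z2 k ` {0..}) \<longleftrightarrow> Bs p \<in> Some ` ray" for p
  proof -
    obtain x y where p: "p = sphere_frac x y" and xy: "x \<noteq> 0 \<or> y \<noteq> 0"
      by (rule sphere_frac_cases)
    have "p \<in> (\<Union>k<n. z1 k ` {0..} \<union> z2 k ` {0..}) \<longleftrightarrow> (\<exists>k<n. \<exists>t\<ge>0. p \<in> {z1 k t, z2 k t})"
      by auto
    also have "\<dots> \<longleftrightarrow> Bs p \<in> Some ` ray"
      unfolding p Bs_in_ray_iff[OF xy lam] curve[OF xy] \<omega> ..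
    finally show ?thesis .
  qed
  then have "(\<Union>k<n. z1 k ` {0..} \<union> z2 k ` {0..}) = {p. Bs p \<in> Some ` ray}" by blast
  then show ?thesis
    using fundamental_domain_bounded_by_preimage_ray by simp
qed

end
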